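(* Let $m\ge 0$ be an integer, let $K$ be a simplicial complex and let $L\subseteq K$ be a subcomplex of $K$. Then \[ TC_m(K,L)\le TC_m(K). \]
   Context: Simplicial complexes are abstract simplicial complexes. The categorical product $K\prod L$ has vertex set $V(K)\times V(L)$, and a finite set $\sigma$ of vertices is a simplex iff its projections $p_1(\sigma)$ and $p_2(\sigma)$ are simplices of $K$ and $L$ respectively. Let $Z$ be the one-dimensional simplicial complex with vertices the integers and edges $\{i,i+1\}$. A Moore path in $K$ is a simplicial map $\gamma:Z\to K$ that is constant on all $i\le i^-$ and constant on all $i\ge i^+$ for some integers $i^-,i^+$; for non-constant $\gamma$, let $\gamma^-$ be the largest such $i^-$ and $\gamma^+$ the smallest such $i^+$. The initial vertex $\alpha(\gamma)$ is the value $\gamma(i)$ for all sufficiently small $i$, and the final vertex $\omega(\gamma)$ is the value $\gamma(i)$ for all sufficiently large $i$. The length $\ell(\gamma)$ is the number of steps $\gamma^+-\gamma^-$ from the initial to the final vertex ($0$ for a constant path). The Moore path complex $PK=P(K)$ has the Moore paths in $K$ as vertices, and $\{\gamma_0,\dots,\gamma_p\}$ is a simplex iff $\{\gamma_0(i),\dots,\gamma_p(i),\gamma_0(i+1),\dots,\gamma_p(i+1)\}$ is a simplex of $K$ for every integer $i$. $P_m(K)$ is the full subcomplex of $PK$ on the paths with $\ell(\gamma)\le m$. $P(K,L)$ is the subcomplex $\omega^{-1}(L)$ of $PK$ (paths ending in $L$; simplices of $PK$ whose image under $\omega$ is a simplex of $L$), and $P_m(K,L)=\{\gamma\in P(K,L):\ell(\gamma)\le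 m\}$ is the full subcomplex of $P(K,L)$ on those paths. In both cases $\pi_m(\gamma)=(\alpha(\gamma),\omega(\gamma))$, giving simplicial maps $\pi_m:P_m(K)\to K\prod K$ and $\pi_m:P_m(K,L)\to K\prod L$. The simplicial Švarc genus $secat(\phi)$ of a simplicial map $\phi:A\to B$ is the least $n\ge0$ such that $B$ is a union of $n+1$ subcomplexes $B_0,\dots,B_n$, each admitting a simplicial map $\sigma_j:B_j\to A$ with $\phi\circ\sigma_j$ equal to the inclusion $B_j\hookrightarrow B$ ($\infty$ if no such $n$ exists). Define $TC_m(K)=secat(\pi_m:P_m(K)\to K\prod K)$ and $TC_m(K,L)=secat(\pi_m:P_m(K,L)\to K\prod L)$. *)

theory Defs
  imports "HOL-Library.Extended_Nat"
begin

text \<open>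
  A complex is represented by its set of simplices; simplices are nonempty finite sets.
  Finiteness of the complex itself is not required, and the empty complex is allowed.
\<close>

definition simplicial_complex :: "'a set set \<Rightarrow> bool" where
  "simplicial_complex K \<longleftrightarrow>
     (\<forall>\<sigma>\<in>K. finite \<sigma> \<and> \<sigma> \<noteq> {}) \<and>
     (\<forall>\<sigma>\<in>K. \<forall>\<tau>. \<tau> \<subseteq> \<sigma> \<and> \<tau> \<noteq> {} \<longrightarrow> \<tau> \<in> K)"

definition vertices :: "'a set set \<Rightarrow> 'a set" where
  "vertices K = {v. {v} \<in> K}"

definition subcomplex :: "'a set set \<Rightarrow> 'a set set \<Rightarrow> bool" where
  "subcomplex L K \<longleftrightarrow> simplicial_complex L \<and> L \<subseteq> K"

definition full_subcomplex :: "'a set set \<Rightarrow> 'a set \<Rightarrow> 'a set set" where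
  "full_subcomplex K W = {\<sigma>\<in>K. \<sigma> \<subseteq> W}"

text \<open>
  Since every vertex spans a simplex, the condition below also forces \<open>f\<close> to send vertices to
  vertices. Only the values of \<open>f\<close> on the vertices of \<open>K\<close> are relevant.
\<close>

definition simplicial_map :: "'a set set \<Rightarrow> 'b set set \<Rightarrow> ('a \<Rightarrow> 'b) \<Rightarrow> bool" where
  "simplicial_map K L f \<longleftrightarrow> (\<forall>\<sigma>\<in>K. f ` \<sigma> \<in> L)"

definition categorical_product :: "'a set set \<Rightarrow> 'b set set \<Rightarrow> ('a \<times> 'b) set set" where
  "categorical_product K L =
     {\<sigma>. finite \<sigma> \<and> \<sigma> \<subseteq> vertices K \<times> vertices L \<and> fst ` \<sigma> \<in> K \<and> snd ` \<sigma> \<in> L}"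

definition Z_complex :: "int set set" where
  "Z_complex = (\<Union>i. {{i}, {i, i + 1}})"

definition constant_below :: "(int \<Rightarrow> 'a) \<Rightarrow> int \<Rightarrow> bool" where
  "constant_below \<gamma> a \<longleftrightarrow> (\<exists>c. \<forall>i\<le>a. \<gamma> i = c)"

definition constant_above :: "(int \<Rightarrow> 'a) \<Rightarrow> int \<Rightarrow> bool" where
  "constant_above \<gamma> b \<longleftrightarrow> (\<exists>c. \<forall>i\<ge>b. \<gamma> i = c)"

definition moore_path :: "'a set set \<Rightarrow> (int \<Rightarrow> 'a) \<Rightarrow> bool" where
  "moore_path K \<gamma> \<longleftrightarrow>
     simplicial_map Z_complex K \<gamma> \<and>
     (\<exists>a. constant_below \<gamma> a) \<and> (\<exists>b. constant_above \<gamma> b)"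

definition initial_vertex :: "(int \<Rightarrow> 'a) \<Rightarrow> 'a" where
  "initial_vertex \<gamma> = (THE v. \<forall>\<^sub>F i in at_bot. \<gamma> i = v)"

definition final_vertex :: "(int \<Rightarrow> 'a) \<Rightarrow> 'a" where
  "final_vertex \<gamma> = (THE v. \<forall>\<^sub>F i in at_top. \<gamma> i = v)"

text \<open>
  The two numbers \<open>GREATEST a. \<dots>\<close> and \<open>LEAST b. \<dots>\<close> exist exactly when the Moore path \<open>\<gamma>\<close> is
  not constant, which is why constant paths are treated separately.
\<close>

definition path_length :: "(int \<Rightarrow> 'a) \<Rightarrow> int" where
  "path_length \<gamma> =
     (if \<exists>c. \<forall>i. \<gamma> i = c then 0
      else (LEAST b. constant_above \<gamma> b) - (GREATEST a. constant_below \<gamma> a))"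

definition moore_path_complex :: "'a set set \<Rightarrow> (int \<Rightarrow> 'a) set set" where
  "moore_path_complex K =
     {\<Gamma>. finite \<Gamma> \<and> \<Gamma> \<noteq> {} \<and> (\<forall>\<gamma>\<in>\<Gamma>. moore_path K \<gamma>) \<and>
         (\<forall>i. (\<lambda>\<gamma>. \<gamma> i) ` \<Gamma> \<union> (\<lambda>\<gamma>. \<gamma> (i + 1)) ` \<Gamma> \<in> K)}"

definition bounded_path_complex :: "nat \<Rightarrow> 'a set set \<Rightarrow> (int \<Rightarrow> 'a) set set" where
  "bounded_path_complex m K =
     full_subcomplex (moore_path_complex K) {\<gamma>. path_length \<gamma> \<le> int m}"

definition relative_path_complex :: "'a set set \<Rightarrow> 'a set set \<Rightarrow> (int \<Rightarrow> 'a) set set" where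
  "relative_path_complex K L = {\<Gamma> \<in> moore_path_complex K. final_vertex ` \<Gamma> \<in> L}"

definition bounded_relative_path_complex ::
    "nat \<Rightarrow> 'a set set \<Rightarrow> 'a set set \<Rightarrow> (int \<Rightarrow> 'a) set set" where
  "bounded_relative_path_complex m K L =
     full_subcomplex (relative_path_complex K L) {\<gamma>. path_length \<gamma> \<le> int m}"

definition endpoints :: "(int \<Rightarrow> 'a) \<Rightarrow> 'a \<times> 'a" where
  "endpoints \<gamma> = (initial_vertex \<gamma>, final_vertex \<gamma>)"

text \<open>
  The infimum in \<^typ>\<open>enat\<close> is a minimum for a nonempty set and is \<open>\<infinity>\<close> for the empty set.
\<close>

definition secat :: "'a set set \<Rightarrow> 'b set set \<Rightarrow> ('a \<Rightarrow> 'b) \<Rightarrow> enat" where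
  "secat A B \<phi> = Inf {enat n | n. \<exists>C.
     (\<forall>j\<le>n. subcomplex (C j) B) \<and>
     (\<Union>j\<le>n. C j) = B \<and>
     (\<forall>j\<le>n. \<exists>s. simplicial_map (C j) A s \<and> (\<forall>v\<in>vertices (C j). \<phi> (s v) = v))}"

definition TC :: "nat \<Rightarrow> 'a set set \<Rightarrow> enat" where
  "TC m K = secat (bounded_path_complex m K) (categorical_product K K) endpoints"

definition TC_rel :: "nat \<Rightarrow> 'a set set \<Rightarrow> 'a set set \<Rightarrow> enat" where
  "TC_rel m K L = secat (bounded_relative_path_complex m K L) (categorical_product K L) endpoints"

end

theory Submission
  imports Defs
begin

text \<open>
  The genus does not grow when a map is restricted to the part of its source lying over a
  subcomplex of its target: a cover with sections may be intersected with that subcomplex, and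
  the restricted sections land over it because they are sections (\<open>secat_restrict_le\<close>).
  The relative invariant arises from the absolute one in this way. A simplex of bounded paths
  whose endpoint pairs form a simplex of the product of \<open>K\<close> and \<open>L\<close> has its final vertices
  forming a simplex of \<open>L\<close>, hence it is a simplex of the relative path complex
  (\<open>bounded_path_simplex_over_product\<close>).
\<close>

lemma simplicial_complex_face:
  assumes "simplicial_complex K" and "\<sigma> \<in> K" and "\<tau> \<subseteq> \<sigma>" and "\<tau> \<noteq> {}"
  shows "\<tau> \<in> K"
proof -
  have "\<forall>\<sigma>\<in>K. \<forall>\<tau>. \<tau> \<subseteq> \<sigma> \<and> \<tau> \<noteq> {} \<longrightarrow> \<tau> \<in> K"
    using assms(1) unfolding simplicial_complex_def by (rule conjunct2)
  from bspec[OF this assms(2)] show ?thesis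
    using assms(3,4) by blast
qed

lemma simplicial_complexI:
  assumes "\<And>\<sigma>. \<sigma> \<in> K \<Longrightarrow> finite \<sigma>" and "{} \<notin> K"
    and "\<And>\<sigma> \<tau>. \<sigma> \<in> K \<Longrightarrow> \<tau> \<subseteq> \<sigma> \<Longrightarrow> \<tau> \<noteq> {} \<Longrightarrow> \<tau> \<in> K"
  shows "simplicial_complex K"
  unfolding simplicial_complex_def using assms by metis

lemma simplicial_complex_finite: "simplicial_complex K \<Longrightarrow> \<sigma> \<in> K \<Longrightarrow> finite \<sigma>"
  unfolding simplicial_complex_def by (drule conjunct1) blast

lemma simplicial_complex_empty_notin: "simplicial_complex K \<Longrightarrow> {} \<notin> K"
  unfolding simplicial_complex_def by (drule conjunct1) blast

lemma simplicial_complex_Int: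
  assumes "simplicial_complex K" and "simplicial_complex L"
  shows "simplicial_complex (K \<inter> L)"
proof (rule simplicial_complexI)
  show "finite \<sigma>" if "\<sigma> \<in> K \<inter> L" for \<sigma>
    using that simplicial_complex_finite[OF assms(1)] by blast
  show "{} \<notin> K \<inter> L"
    using simplicial_complex_empty_notin[OF assms(1)] by blast
  show "\<tau> \<in> K \<inter> L" if "\<sigma> \<in> K \<inter> L" "\<tau> \<subseteq> \<sigma>" "\<tau> \<noteq> {}" for \<sigma> \<tau>
    using that simplicial_complex_face[OF assms(1), of \<sigma> \<tau>]
      simplicial_complex_face[OF assms(2), of \<sigma> \<tau>] by blast
qed

lemma vertices_mono: "K \<subseteq> L \<Longrightarrow> vertices K \<subseteq> vertices L"
  by (auto simp: vertices_def)

lemma simplex_subset_vertices: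
  assumes "simplicial_complex K" and "\<sigma> \<in> K"
  shows "\<sigma> \<subseteq> vertices K"
  using simplicial_complex_face[OF assms, of "{_}"] by (simp add: vertices_def subset_iff)

lemma simplicial_complex_categorical_product:
  assumes K: "simplicial_complex K" and L: "simplicial_complex L"
  shows "simplicial_complex (categorical_product K L)"
proof (rule simplicial_complexI)
  show "finite \<sigma>" if "\<sigma> \<in> categorical_product K L" for \<sigma>
    using that by (simp add: categorical_product_def)
  show "{} \<notin> categorical_product K L"
    using simplicial_complex_empty_notin[OF K] by (simp add: categorical_product_def)
  show "\<tau> \<in> categorical_product K L"
    if \<sigma>: "\<sigma> \<in> categorical_product K L" and \<tau>: "\<tau> \<subseteq> \<sigma>" "\<tau> \<noteq> {}" for \<sigma> \<tau>
  proof -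
    have "fst ` \<sigma> \<in> K" "snd ` \<sigma> \<in> L"
      using \<sigma> by (simp_all add: categorical_product_def)
    then have "fst ` \<tau> \<in> K" "snd ` \<tau> \<in> L"
      using \<tau> simplicial_complex_face[OF K, of "fst ` \<sigma>" "fst ` \<tau>"]
        simplicial_complex_face[OF L, of "snd ` \<sigma>" "snd ` \<tau>"]
      by (simp_all add: image_mono)
    moreover have "finite \<tau>"
      using \<sigma> \<tau>(1) finite_subset by (simp add: categorical_product_def) blast
    moreover have "\<tau> \<subseteq> vertices K \<times> vertices L"
      using \<sigma> \<tau>(1) by (simp add: categorical_product_def) blast
    ultimately show ?thesis
      by (simp add: categorical_product_def)
  qed
qed

lemma categorical_product_mono_right:
  assumes "L \<subseteq> L'"
  shows "categorical_product K L \<subseteq> categorical_product K L'"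
  using assms vertices_mono[OF assms] unfolding categorical_product_def by blast

text \<open>
  A section \<open>s\<close> satisfies \<open>\<phi> ` s ` \<sigma> = \<sigma>\<close> for every simplex \<open>\<sigma>\<close> in its domain, so simplices of
  \<open>B'\<close> are sent to simplices of \<open>A\<close> lying over \<open>B'\<close>. This is why \<open>A'\<close> only has to contain the
  latter.
\<close>

lemma secat_restrict_le:
  assumes B': "subcomplex B' B"
    and A': "\<And>\<tau>. \<tau> \<in> A \<Longrightarrow> \<phi> ` \<tau> \<in> B' \<Longrightarrow> \<tau> \<in> A'"
  shows "secat A' B' \<phi> \<le> secat A B \<phi>"
  unfolding secat_def
proof (rule Inf_superset_mono, clarify)
  fix n :: nat and C
  assume C: "\<forall>j\<le>n. subcomplex (C j) (\<Union>j\<le>n. C j)"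
    and B: "B = (\<Union>j\<le>n. C j)"
    and sections: "\<forall>j\<le>n. \<exists>s. simplicial_map (C j) A s \<and> (\<forall>v\<in>vertices (C j). \<phi> (s v) = v)"
  define D where "D j = C j \<inter> B'" for j :: nat
  have "subcomplex (D j) B'" if "j \<le> n" for j
    using C B' that unfolding D_def subcomplex_def by (blast intro: simplicial_complex_Int)
  moreover have "(\<Union>j\<le>n. D j) = B'"
    using B' by (auto simp: D_def B subcomplex_def)
  moreover have "\<exists>s. simplicial_map (D j) A' s \<and> (\<forall>v\<in>vertices (D j). \<phi> (s v) = v)"
    if j: "j \<le> n" for j
  proof -
    obtain s where s: "simplicial_map (C j) A s" "\<forall>v\<in>vertices (C j). \<phi> (s v) = v"
      using sections j by blast
    have "s ` \<sigma> \<in> A'" if \<sigma>: "\<sigma> \<in> D j" for \<sigma>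
    proof (rule A')
      show "s ` \<sigma> \<in> A"
        using s(1) \<sigma> by (simp add: simplicial_map_def D_def)
      have "\<sigma> \<subseteq> vertices (C j)"
        using C j \<sigma> by (intro simplex_subset_vertices) (auto simp: subcomplex_def D_def)
      then have "\<phi> ` s ` \<sigma> = \<sigma>"
        using s(2) by (simp add: image_image subset_iff)
      then show "\<phi> ` s ` \<sigma> \<in> B'"
        using \<sigma> by (simp add: D_def)
    qed
    moreover have "vertices (D j) \<subseteq> vertices (C j)"
      by (intro vertices_mono) (simp add: D_def)
    ultimately show ?thesis
      using s(2) by (auto simp: simplicial_map_def)
  qed
  ultimately show "\<exists>n'. enat n = enat n' \<and> (\<exists>C. (\<forall>j\<le>n'. subcomplex (C j) B') \<and>
      (\<Union>j\<le>n'. C j) = B' \<and>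
      (\<forall>j\<le>n'. \<exists>s. simplicial_map (C j) A' s \<and> (\<forall>v\<in>vertices (C j). \<phi> (s v) = v)))"
    by (intro exI[of _ n] conjI refl exI[of _ D] allI impI) simp_all
qed

lemma bounded_path_simplex_over_product:
  assumes "\<Gamma> \<in> bounded_path_complex m K"
    and "endpoints ` \<Gamma> \<in> categorical_product K' L"
  shows "\<Gamma> \<in> bounded_relative_path_complex m K L"
  using assms
  by (simp add: bounded_path_complex_def bounded_relative_path_complex_def full_subcomplex_def
      relative_path_complex_def categorical_product_def endpoints_def image_image)

theorem proposition6p3:
  fixes m :: nat and K L :: "'a set set"
  assumes "simplicial_complex K" and "subcomplex L K"
  shows "TC_rel m K L \<le> TC m K"
  unfolding TC_rel_def TC_def
proof (rule secat_restrict_le)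
  show "subcomplex (categorical_product K L) (categorical_product K K)"
    using assms
    by (simp add: subcomplex_def simplicial_complex_categorical_product
        categorical_product_mono_right)
qed (rule bounded_path_simplex_over_product)

end
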